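(* Let $\mathcal{C}$ be a strict monoidal category and $J$ an object of $\mathcal{C}$. Let $\mathcal{C}[J^{\vee}]$ be the strict monoidal category obtained by freely adjoining a right dual $J^{\vee}$ to $J$ (as constructed in the context). Then the inclusion functor $\Omega:\mathcal{C}\to\mathcal{C}[J^{\vee}]$ is full.
   Context: Construction of $\mathcal{C}[J^{\vee}]$. Let $\mathcal{C}$ be a strict monoidal category with tensor $\otimes$ and unit $\mathbb{I}$, and let $J\in\mathcal{C}$. Write $[m]=\{0,1,\dots,m\}$. Let $\mathcal{G}_0$ be the set of all functions $U:[m]\to \mathrm{ob}\,\mathcal{C}$ ($m\ge 0$), written $U=(U_0,\dots,U_m)$; objects of $\mathcal{C}$ are identified with functions $[0]\to\mathrm{ob}\,\mathcal{C}$. For $U:[m]\to\mathrm{ob}\,\mathcal{C}$ and $V:[n]\to\mathrm{ob}\,\mathcal{C}$ define $U\otimes V:[m+n]\to\mathrm{ob}\,\mathcal{C}$ by $(U\otimes V)_i=U_i$ for $i<m$, $(U\otimes V)_m=U_m\otimes V_0$, $(U\otimes V)_i=V_{i-m}$ for $i>m$. This makes $\mathcal{G}_0$ a monoid with unit $\mathbb{I}$. Put $J^{\vee}=(\mathbb{I},\mathbb{I}):[1]\to\mathrm{ob}\,\mathcal{C}$; then every $U$ decomposes uniquely as $U=U_0\otimes J^{\vee}\otimes U_1\otimes J^{\vee}\otimes\dots\otimes J^{\vee}\otimes U_m$ with $U_i\in\mathcal{C}$. Let $\mathcal{G}$ be the directed graph with vertex set $\mathcal{G}_0$ and the following edges.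 The primitive edges are symbols $\varepsilon: J\otimes J^{\vee}\to\mathbb{I}$, $\eta:\mathbb{I}\to J^{\vee}\otimes J$, and $\bar f: C\to D$ for each morphism $f:C\to D$ of $\mathcal{C}$. The general edges are the formal whiskerings $U\otimes p\otimes V: U\otimes A\otimes V\to U\otimes B\otimes V$ with $p:A\to B$ primitive and $U,V\in\mathcal{G}_0$ (with $p$ identified with $\mathbb{I}\otimes p\otimes\mathbb{I}$); put $T\otimes(U\otimes p\otimes V)\otimes W=(T\otimes U)\otimes p\otimes(V\otimes W)$ and extend $U\otimes -\otimes V$ to paths edge by edge. Let $\mathcal{F}\mathcal{G}$ be the free category on $\mathcal{G}$, and let $\sim$ be the congruence on $\mathcal{F}\mathcal{G}$ generated by the following relations ($C,D,E,F\in\mathcal{C}$; $U,V,W,X,Y,Z\in\mathcal{G}_0$): (i) $\overline{E\otimes f\otimes F}\sim E\otimes\bar f\otimes F$ for $f\in\mathcal{C}(C,D)$; (ii) $\overline{1_C}\sim 1_C$, and $\overline{gf}\sim\bar g\,\bar f$ for $f\in\mathcal{C}(C,D)$, $g\in\mathcal{C}(D,E)$; (iii) $(V\otimes b)(a\otimes W)\sim(a\otimes X)(U\otimes b)$ for all edges $a:U\to V$, $b:W\to X$; (iv) $(\varepsilon\otimes J)(J\otimes\eta)\sim 1_J$; (v) $(J^{\vee}\otimes\varepsilon)(\eta\otimes J^{\vee})\sim 1_{J^{\vee}}$; (vi) if $\ell\sim\ell'$ is any of the relations (i)–(v), then $Y\otimes\ell\otimes Z\sim Y\otimes\ell'\otimes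 Z$. Put $\mathcal{C}[J^{\vee}]=\mathcal{F}\mathcal{G}/\sim$. It is strict monoidal: the tensor of objects $U:[m]\to\mathrm{ob}\,\mathcal{C}$ and $V:[n]\to\mathrm{ob}\,\mathcal{C}$ is the product in the monoid $\mathcal{G}_0$, i.e. the function $U\otimes V:[m+n]\to\mathrm{ob}\,\mathcal{C}$ with $(U\otimes V)_i=U_i$ for $i<m$, $(U\otimes V)_m=U_m\otimes V_0$, $(U\otimes V)_i=V_{i-m}$ for $i>m$, and for morphisms $[a]\otimes[b]$ is the class of both sides of (iii), extended to paths. The functor $\Omega:\mathcal{C}\to\mathcal{C}[J^{\vee}]$, $\Omega C=C$, $\Omega f=[\bar f]$, is strict monoidal, and $J\dashv J^{\vee}$ in $\mathcal{C}[J^{\vee}]$ with counit $\varepsilon$ and unit $\eta$. *)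

theory Defs
  imports Main
begin

section \<open>Strict monoidal categories and functors\<close>

record ('o, 'a) cat =
  Obj :: "'o set"
  Arr :: "'a set"
  Dom :: "'a \<Rightarrow> 'o"
  Cod :: "'a \<Rightarrow> 'o"
  Id :: "'o \<Rightarrow> 'a"
  Comp :: "'a \<Rightarrow> 'a \<Rightarrow> 'a"  (infixl "\<cdot>\<index>" 70)

record ('o, 'a) moncat = "('o, 'a) cat" +
  Unit :: "'o"
  TensorO :: "'o \<Rightarrow> 'o \<Rightarrow> 'o"  (infixl "\<otimes>\<index>" 75)
  TensorA :: "'a \<Rightarrow> 'a \<Rightarrow> 'a"  (infixl "\<boxtimes>\<index>" 75)

definition Hom :: "('o, 'a, 'x) cat_scheme \<Rightarrow> 'o \<Rightarrow> 'o \<Rightarrow> 'a set" where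
  "Hom C A B = {f \<in> Arr C. Dom C f = A \<and> Cod C f = B}"

locale category =
  fixes C :: "('o, 'a, 'x) cat_scheme" (structure)
  assumes dom_in: "f \<in> Arr C \<Longrightarrow> Dom C f \<in> Obj C"
    and cod_in: "f \<in> Arr C \<Longrightarrow> Cod C f \<in> Obj C"
    and id_in: "A \<in> Obj C \<Longrightarrow> Id C A \<in> Hom C A A"
    and comp_in: "\<lbrakk>f \<in> Hom C A B; g \<in> Hom C B D\<rbrakk> \<Longrightarrow> g \<cdot> f \<in> Hom C A D"
    and id_right: "f \<in> Hom C A B \<Longrightarrow> f \<cdot> Id C A = f"
    and id_left: "f \<in> Hom C A B \<Longrightarrow> Id C B \<cdot> f = f"
    and comp_assoc:
      "\<lbrakk>f \<in> Hom C A B; g \<in> Hom C B D; h \<in> Hom C D E\<rbrakk> \<Longrightarrow> h \<cdot> g \<cdot> f = h \<cdot> (g \<cdot> f)"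

locale strict_monoidal_category = category C
  for C :: "('o, 'a, 'x) moncat_scheme" (structure) +
  assumes unit_in: "Unit C \<in> Obj C"
    and tensorO_in: "\<lbrakk>A \<in> Obj C; B \<in> Obj C\<rbrakk> \<Longrightarrow> A \<otimes> B \<in> Obj C"
    and tensorA_in:
      "\<lbrakk>f \<in> Hom C A B; g \<in> Hom C A' B'\<rbrakk> \<Longrightarrow> f \<boxtimes> g \<in> Hom C (A \<otimes> A') (B \<otimes> B')"
    and tensor_id:
      "\<lbrakk>A \<in> Obj C; B \<in> Obj C\<rbrakk> \<Longrightarrow> Id C A \<boxtimes> Id C B = Id C (A \<otimes> B)"
    and tensor_comp:
      "\<lbrakk>f \<in> Hom C A B; g \<in> Hom C B D; f' \<in> Hom C A' B'; g' \<in> Hom C B' D'\<rbrakk>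
        \<Longrightarrow> (g \<cdot> f) \<boxtimes> (g' \<cdot> f') = (g \<boxtimes> g') \<cdot> (f \<boxtimes> f')"
    and tensorO_assoc:
      "\<lbrakk>A \<in> Obj C; B \<in> Obj C; D \<in> Obj C\<rbrakk> \<Longrightarrow> A \<otimes> B \<otimes> D = A \<otimes> (B \<otimes> D)"
    and tensorO_unit_left: "A \<in> Obj C \<Longrightarrow> Unit C \<otimes> A = A"
    and tensorO_unit_right: "A \<in> Obj C \<Longrightarrow> A \<otimes> Unit C = A"
    and tensorA_assoc:
      "\<lbrakk>f \<in> Arr C; g \<in> Arr C; h \<in> Arr C\<rbrakk> \<Longrightarrow> f \<boxtimes> g \<boxtimes> h = f \<boxtimes> (g \<boxtimes> h)"
    and tensorA_unit_left: "f \<in> Arr C \<Longrightarrow> Id C (Unit C) \<boxtimes> f = f"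
    and tensorA_unit_right: "f \<in> Arr C \<Longrightarrow> f \<boxtimes> Id C (Unit C) = f"

locale cat_functor = A: category A + B: category B
  for A :: "('o, 'a, 'x) cat_scheme" and B :: "('p, 'b, 'y) cat_scheme" +
  fixes Fo :: "'o \<Rightarrow> 'p" and Fa :: "'a \<Rightarrow> 'b"
  assumes map_obj: "X \<in> Obj A \<Longrightarrow> Fo X \<in> Obj B"
    and map_arr: "f \<in> Hom A X Y \<Longrightarrow> Fa f \<in> Hom B (Fo X) (Fo Y)"
    and map_id: "X \<in> Obj A \<Longrightarrow> Fa (Id A X) = Id B (Fo X)"
    and map_comp:
      "\<lbrakk>f \<in> Hom A X Y; g \<in> Hom A Y Z\<rbrakk> \<Longrightarrow> Fa (g \<cdot>\<^bsub>A\<^esub> f) = Fa g \<cdot>\<^bsub>B\<^esub> Fa f"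

locale full_functor = cat_functor +
  assumes full: "\<lbrakk>X \<in> Obj A; Y \<in> Obj A; g \<in> Hom B (Fo X) (Fo Y)\<rbrakk>
    \<Longrightarrow> \<exists>f \<in> Hom A X Y. Fa f = g"


section \<open>The graph of words\<close>

text \<open>
  A function from \<open>{0..m}\<close> to the objects of \<open>C\<close> is encoded as the nonempty list of its
  \<open>m + 1\<close> values; an object \<open>A\<close> of \<open>C\<close> is identified with the list \<open>[A]\<close>.
\<close>

definition words :: "('o, 'a, 'x) moncat_scheme \<Rightarrow> 'o list set" where
  "words C = {U. U \<noteq> [] \<and> set U \<subseteq> Obj C}"

definition wtensor :: "('o, 'a, 'x) moncat_scheme \<Rightarrow> 'o list \<Rightarrow> 'o list \<Rightarrow> 'o list"
    (infixl "\<odot>\<index>" 75) where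
  "U \<odot>\<^bsub>C\<^esub> V = butlast U @ [last U \<otimes>\<^bsub>C\<^esub> hd V] @ tl V"

lemma length_wtensor:
  "\<lbrakk>length U = m + 1; length V = n + 1\<rbrakk> \<Longrightarrow> length (U \<odot>\<^bsub>C\<^esub> V) = m + n + 1"
  by (simp add: wtensor_def)

lemma nth_wtensor:
  assumes "length U = m + 1" "length V = n + 1" "i \<le> m + n"
  shows "(U \<odot>\<^bsub>C\<^esub> V) ! i =
    (if i < m then U ! i else if i = m then U ! m \<otimes>\<^bsub>C\<^esub> V ! 0 else V ! (i - m))"
proof -
  have "U \<noteq> []" "V \<noteq> []" using assms by auto
  then show ?thesis using assms
    by (auto simp: wtensor_def nth_append nth_butlast nth_tl last_conv_nth hd_conv_nth
        nth_Cons split: nat.splits)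
qed

abbreviation unit_word :: "('o, 'a, 'x) moncat_scheme \<Rightarrow> 'o list" where
  "unit_word C \<equiv> [Unit C]"

definition dual_word :: "('o, 'a, 'x) moncat_scheme \<Rightarrow> 'o list" where
  "dual_word C = [Unit C, Unit C]"

text \<open>
  The adjoined dual \<open>J\<^sup>\<or>\<close> is \<open>dual_word C\<close>; \<open>Counit\<close>, \<open>Coev\<close> and \<open>Bar f\<close> are the symbols
  \<open>\<epsilon> : J \<otimes> J\<^sup>\<or> \<rightarrow> I\<close>, \<open>\<eta> : I \<rightarrow> J\<^sup>\<or> \<otimes> J\<close> and \<open>f\<close> with a bar, respectively.
\<close>

datatype 'a prim = Counit | Coev | Bar 'a

fun prim_dom :: "('o, 'a, 'x) moncat_scheme \<Rightarrow> 'o \<Rightarrow> 'a prim \<Rightarrow> 'o list" where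
  "prim_dom C J Counit = [J] \<odot>\<^bsub>C\<^esub> dual_word C"
| "prim_dom C J Coev = unit_word C"
| "prim_dom C J (Bar f) = [Dom C f]"

fun prim_cod :: "('o, 'a, 'x) moncat_scheme \<Rightarrow> 'o \<Rightarrow> 'a prim \<Rightarrow> 'o list" where
  "prim_cod C J Counit = unit_word C"
| "prim_cod C J Coev = dual_word C \<odot>\<^bsub>C\<^esub> [J]"
| "prim_cod C J (Bar f) = [Cod C f]"

definition prims :: "('o, 'a, 'x) moncat_scheme \<Rightarrow> 'a prim set" where
  "prims C = {Counit, Coev} \<union> Bar ` Arr C"

text \<open>The triple \<open>(U, p, V)\<close> is the formal whiskering \<open>U \<otimes> p \<otimes> V\<close>.\<close>

type_synonym ('o, 'a) edge = "'o list \<times> 'a prim \<times> 'o list"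

definition edges :: "('o, 'a, 'x) moncat_scheme \<Rightarrow> ('o, 'a) edge set" where
  "edges C = words C \<times> prims C \<times> words C"

fun edge_dom :: "('o, 'a, 'x) moncat_scheme \<Rightarrow> 'o \<Rightarrow> ('o, 'a) edge \<Rightarrow> 'o list" where
  "edge_dom C J (U, p, V) = U \<odot>\<^bsub>C\<^esub> prim_dom C J p \<odot>\<^bsub>C\<^esub> V"

fun edge_cod :: "('o, 'a, 'x) moncat_scheme \<Rightarrow> 'o \<Rightarrow> ('o, 'a) edge \<Rightarrow> 'o list" where
  "edge_cod C J (U, p, V) = U \<odot>\<^bsub>C\<^esub> prim_cod C J p \<odot>\<^bsub>C\<^esub> V"

fun whisker_edge ::
  "('o, 'a, 'x) moncat_scheme \<Rightarrow> 'o list \<Rightarrow> ('o, 'a) edge \<Rightarrow> 'o list \<Rightarrow> ('o, 'a) edge" where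
  "whisker_edge C T (U, p, V) W = (T \<odot>\<^bsub>C\<^esub> U, p, V \<odot>\<^bsub>C\<^esub> W)"


section \<open>The free category on the graph\<close>

text \<open>
  A path \<open>(U, es, V)\<close> runs from \<open>U\<close> to \<open>V\<close>; its edges are listed in the order in which they
  are traversed, so the composite \<open>q p\<close> (first \<open>p\<close>, then \<open>q\<close>) has the edges of \<open>p\<close> first.
\<close>

type_synonym ('o, 'a) path = "'o list \<times> ('o, 'a) edge list \<times> 'o list"

fun is_path ::
  "('o, 'a, 'x) moncat_scheme \<Rightarrow> 'o \<Rightarrow> 'o list \<Rightarrow> ('o, 'a) edge list \<Rightarrow> 'o list \<Rightarrow> bool" where
  "is_path C J U [] V \<longleftrightarrow> U \<in> words C \<and> U = V"
| "is_path C J U (e # es) V \<longleftrightarrow>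
     e \<in> edges C \<and> edge_dom C J e = U \<and> is_path C J (edge_cod C J e) es V"

definition paths :: "('o, 'a, 'x) moncat_scheme \<Rightarrow> 'o \<Rightarrow> ('o, 'a) path set" where
  "paths C J = {(U, es, V). is_path C J U es V}"

fun path_dom :: "('o, 'a) path \<Rightarrow> 'o list" where
  "path_dom (U, es, V) = U"

fun path_cod :: "('o, 'a) path \<Rightarrow> 'o list" where
  "path_cod (U, es, V) = V"

definition path_id :: "'o list \<Rightarrow> ('o, 'a) path" where
  "path_id U = (U, [], U)"

fun path_comp :: "('o, 'a) path \<Rightarrow> ('o, 'a) path \<Rightarrow> ('o, 'a) path"  (infixl "\<bullet>" 70) where
  "(V', fs, W) \<bullet> (U, es, V) = (U, es @ fs, W)"

definition edge_path :: "('o, 'a, 'x) moncat_scheme \<Rightarrow> 'o \<Rightarrow> ('o, 'a) edge \<Rightarrow> ('o, 'a) path" where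
  "edge_path C J e = (edge_dom C J e, [e], edge_cod C J e)"

definition prim_path :: "('o, 'a, 'x) moncat_scheme \<Rightarrow> 'o \<Rightarrow> 'a prim \<Rightarrow> ('o, 'a) path" where
  "prim_path C J p = edge_path C J (unit_word C, p, unit_word C)"

fun whisker ::
  "('o, 'a, 'x) moncat_scheme \<Rightarrow> 'o list \<Rightarrow> ('o, 'a) path \<Rightarrow> 'o list \<Rightarrow> ('o, 'a) path" where
  "whisker C T (U, es, V) W =
     (T \<odot>\<^bsub>C\<^esub> U \<odot>\<^bsub>C\<^esub> W, map (\<lambda>e. whisker_edge C T e W) es, T \<odot>\<^bsub>C\<^esub> V \<odot>\<^bsub>C\<^esub> W)"

abbreviation whisker_left ::
  "('o, 'a, 'x) moncat_scheme \<Rightarrow> 'o list \<Rightarrow> ('o, 'a) path \<Rightarrow> ('o, 'a) path" where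
  "whisker_left C T p \<equiv> whisker C T p (unit_word C)"

abbreviation whisker_right ::
  "('o, 'a, 'x) moncat_scheme \<Rightarrow> ('o, 'a) path \<Rightarrow> 'o list \<Rightarrow> ('o, 'a) path" where
  "whisker_right C p W \<equiv> whisker C (unit_word C) p W"


section \<open>The congruence and the quotient\<close>

inductive basic_rel ::
  "('o, 'a, 'x) moncat_scheme \<Rightarrow> 'o \<Rightarrow> ('o, 'a) path \<Rightarrow> ('o, 'a) path \<Rightarrow> bool"
  for C :: "('o, 'a, 'x) moncat_scheme" and J :: 'o where
  bar_whisker: "\<lbrakk>f \<in> Arr C; E \<in> Obj C; F \<in> Obj C\<rbrakk> \<Longrightarrow>
    basic_rel C J (prim_path C J (Bar (Id C E \<boxtimes>\<^bsub>C\<^esub> f \<boxtimes>\<^bsub>C\<^esub> Id C F)))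
      (whisker C [E] (prim_path C J (Bar f)) [F])"
| bar_id: "A \<in> Obj C \<Longrightarrow>
    basic_rel C J (prim_path C J (Bar (Id C A))) (path_id [A])"
| bar_comp: "\<lbrakk>f \<in> Hom C A B; g \<in> Hom C B D\<rbrakk> \<Longrightarrow>
    basic_rel C J (prim_path C J (Bar (g \<cdot>\<^bsub>C\<^esub> f)))
      (prim_path C J (Bar g) \<bullet> prim_path C J (Bar f))"
| interchange: "\<lbrakk>a \<in> edges C; edge_dom C J a = U; edge_cod C J a = V;
      b \<in> edges C; edge_dom C J b = W; edge_cod C J b = X\<rbrakk> \<Longrightarrow>
    basic_rel C J
      (whisker_left C V (edge_path C J b) \<bullet> whisker_right C (edge_path C J a) W)
      (whisker_right C (edge_path C J a) X \<bullet> whisker_left C U (edge_path C J b))"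
| triangle_J: "basic_rel C J
    (whisker_right C (prim_path C J Counit) [J] \<bullet> whisker_left C [J] (prim_path C J Coev))
    (path_id [J])"
| triangle_dual: "basic_rel C J
    (whisker_left C (dual_word C) (prim_path C J Counit) \<bullet>
      whisker_right C (prim_path C J Coev) (dual_word C))
    (path_id (dual_word C))"

inductive_set path_cong ::
  "('o, 'a, 'x) moncat_scheme \<Rightarrow> 'o \<Rightarrow> (('o, 'a) path \<times> ('o, 'a) path) set"
  for C :: "('o, 'a, 'x) moncat_scheme" and J :: 'o where
  basic: "basic_rel C J p q \<Longrightarrow> (p, q) \<in> path_cong C J"
| whiskered: "\<lbrakk>basic_rel C J p q; Y \<in> words C; Z \<in> words C\<rbrakk> \<Longrightarrow>
    (whisker C Y p Z, whisker C Y q Z) \<in> path_cong C J"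
| refl: "p \<in> paths C J \<Longrightarrow> (p, p) \<in> path_cong C J"
| sym: "(p, q) \<in> path_cong C J \<Longrightarrow> (q, p) \<in> path_cong C J"
| trans: "\<lbrakk>(p, q) \<in> path_cong C J; (q, r) \<in> path_cong C J\<rbrakk> \<Longrightarrow> (p, r) \<in> path_cong C J"
| comp: "\<lbrakk>(p, p') \<in> path_cong C J; (q, q') \<in> path_cong C J; path_cod p = path_dom q\<rbrakk> \<Longrightarrow>
    (q \<bullet> p, q' \<bullet> p') \<in> path_cong C J"

text \<open>
  For \<open>p : U \<rightarrow> V\<close> and \<open>q : W \<rightarrow> X\<close> the tensor is represented by \<open>(V \<otimes> q) (p \<otimes> W)\<close>.
\<close>

definition path_tensor ::
  "('o, 'a, 'x) moncat_scheme \<Rightarrow> ('o, 'a) path \<Rightarrow> ('o, 'a) path \<Rightarrow> ('o, 'a) path" where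
  "path_tensor C p q = whisker_left C (path_cod p) q \<bullet> whisker_right C p (path_dom q)"

text \<open>
  All paths in a class have the same endpoints, so \<^const>\<open>the_elem\<close> below is applied to a
  singleton; the unions are those of the usual lifting of operations to equivalence classes.
\<close>

definition adjoin_dual ::
  "('o, 'a, 'x) moncat_scheme \<Rightarrow> 'o \<Rightarrow> ('o list, ('o, 'a) path set) moncat" where
  "adjoin_dual C J =
    \<lparr>Obj = words C,
     Arr = paths C J // path_cong C J,
     Dom = (\<lambda>c. the_elem (path_dom ` c)),
     Cod = (\<lambda>c. the_elem (path_cod ` c)),
     Id = (\<lambda>U. path_cong C J `` {path_id U}),
     Comp = (\<lambda>d c. \<Union>q\<in>d. \<Union>p\<in>c. path_cong C J `` {q \<bullet> p}),
     Unit = unit_word C,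
     TensorO = wtensor C,
     TensorA = (\<lambda>c d. \<Union>p\<in>c. \<Union>q\<in>d. path_cong C J `` {path_tensor C p q})\<rparr>"

definition incl_obj :: "'o \<Rightarrow> 'o list" where
  "incl_obj A = [A]"

definition incl_arr :: "('o, 'a, 'x) moncat_scheme \<Rightarrow> 'o \<Rightarrow> 'a \<Rightarrow> ('o, 'a) path set" where
  "incl_arr C J f = path_cong C J `` {prim_path C J (Bar f)}"

end

theory Submission
  imports Defs
begin

text \<open>
  Every path out of an object \<open>A\<close> of \<open>C\<close> is congruent to one without counits. Indeed, consider the
  first counit of a path. It deletes a copy of \<open>J\<^sup>\<or>\<close> that was created earlier by some unit, and in
  between this copy separates each word into a left and a right part on which the edges act
  independently. By interchange the path between creation and deletion is congruent to
  \<open>(P \<otimes> \<epsilon> \<otimes> Q) (p \<otimes> J\<^sup>\<or> \<otimes> q) (U \<otimes> \<eta> \<otimes> V)\<close> with \<open>p : U \<rightarrow> P \<otimes> J\<close> and \<open>q : J \<otimes> V \<rightarrow> Q\<close>, and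
  postponing \<open>\<eta>\<close> until after \<open>p\<close>, advancing \<open>\<epsilon>\<close> before \<open>q\<close>, and applying the triangle identity
  on \<open>J\<close> turns this into \<open>(P \<otimes> q) (p \<otimes> V)\<close>. A path without counits between words of length one
  contains no units either, since units increase the length; so it consists of morphisms of \<open>C\<close>.
\<close>

locale pointed_monoidal_category = strict_monoidal_category C
  for C :: "('o, 'a, 'x) moncat_scheme" (structure) +
  fixes J :: 'o
  assumes J_in: "J \<in> Obj C"
begin

subsection \<open>Words\<close>

abbreviation wunit :: "'o list" where "wunit \<equiv> unit_word C"

abbreviation dual :: "'o list" where "dual \<equiv> dual_word C"

declare unit_in [simp] J_in [simp] tensorO_unit_left [simp] tensorO_unit_right [simp]

lemma singleton_words [simp]: "[A] \<in> words C \<longleftrightarrow> A \<in> Obj C"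
  by (simp add: words_def)

lemma dual_words [simp]: "dual \<in> words C"
  by (simp add: words_def dual_word_def)

lemma words_append [simp]: "U \<noteq> [] \<Longrightarrow> V \<noteq> [] \<Longrightarrow> U @ V \<in> words C \<longleftrightarrow> U \<in> words C \<and> V \<in> words C"
  by (auto simp: words_def)

lemma words_not_Nil: "U \<in> words C \<Longrightarrow> U \<noteq> []"
  by (simp add: words_def)

lemma words_appendI [simp]: "U \<in> words C \<Longrightarrow> V \<in> words C \<Longrightarrow> U @ V \<in> words C"
  by (simp add: words_not_Nil)

lemma words_last: "U \<in> words C \<Longrightarrow> last U \<in> Obj C"
  by (auto simp: words_def)

lemma words_hd: "U \<in> words C \<Longrightarrow> hd U \<in> Obj C"
  by (auto simp: words_def)

lemma wtensor_words [simp]: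
  assumes "U \<in> words C" "V \<in> words C"
  shows "U \<odot> V \<in> words C"
  using assms words_last[OF assms(1)] words_hd[OF assms(2)]
  by (auto simp: words_def wtensor_def tensorO_in dest: in_set_butlastD list.set_sel(2))

text \<open>If \<open>V\<close> has at least two entries, the two products merge different entries
  and do not interfere. A one-entry \<open>V\<close> is merged from both sides, and there
  associativity of the tensor of \<open>C\<close> enters.\<close>

lemma wtensor_assoc [simp]:
  assumes "U \<in> words C" "V \<in> words C" "W \<in> words C"
  shows "U \<odot> V \<odot> W = U \<odot> (V \<odot> W)"
proof (cases "tl V")
  case Nil
  then obtain v where "V = [v]" using words_not_Nil[OF assms(2)] by (cases V) auto
  then show ?thesis
    using assms words_last[OF assms(1)] words_hd[OF assms(3)]
    by (simp add: wtensor_def tensorO_assoc butlast_append)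
next
  case (Cons v vs)
  then show ?thesis
    using words_not_Nil[OF assms(2)] by (cases V) (auto simp: wtensor_def butlast_append)
qed

lemma wtensor_unit_left [simp]: "U \<in> words C \<Longrightarrow> wunit \<odot> U = U"
  using words_hd[of U] words_not_Nil[of U] by (simp add: wtensor_def)

lemma wtensor_unit_right [simp]: "U \<in> words C \<Longrightarrow> U \<odot> wunit = U"
  using words_last[of U] words_not_Nil[of U] by (simp add: wtensor_def)

lemma singleton_wtensor [simp]: "[A] \<odot> [B] = [A \<otimes> B]"
  by (simp add: wtensor_def)

text \<open>Both merged entries are tensored with the unit, so \<open>dual\<close> merely keeps the
  lists apart: a copy of the dual is a boundary between adjacent entries. As a simp rule this erases
  \<open>dual\<close>, so it is switched off below wherever the shape of a word matters.\<close>

lemma wtensor_dual [simp]: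
  assumes "U \<in> words C" "V \<in> words C"
  shows "U \<odot> (dual \<odot> V) = U @ V"
  using assms words_last[of U] words_hd[of V] words_not_Nil[of U] words_not_Nil[of V]
  by (simp add: wtensor_def dual_word_def)

lemma length_wtensor': "U \<in> words C \<Longrightarrow> V \<in> words C \<Longrightarrow> length (U \<odot> V) + 1 = length U + length V"
  using words_not_Nil[of U] words_not_Nil[of V] by (simp add: wtensor_def Suc_leI)

text \<open>Tensoring with a single object fuses the last entry of \<open>P\<close> with the first
  of \<open>Q\<close>, so every boundary between entries comes from inside \<open>P\<close> or from
  inside \<open>Q\<close>.\<close>

lemma wtensor_singleton_eq_append:
  assumes "P \<in> words C" "Q \<in> words C" "X \<noteq> []" "Y \<noteq> []" "P \<odot> ([A] \<odot> Q) = X @ Y"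
  obtains (left) P' where "P' \<noteq> []" "P = X @ P'" "Y = P' \<odot> ([A] \<odot> Q)"
  | (right) Q' where "Q' \<noteq> []" "Q = Q' @ Y" "X = P \<odot> ([A] \<odot> Q')"
proof -
  obtain P0 p where P: "P = P0 @ [p]" using words_not_Nil[OF assms(1)] by (metis rev_exhaust)
  obtain q Q0 where Q: "Q = q # Q0" using words_not_Nil[OF assms(2)] by (cases Q) auto
  have "P0 @ (p \<otimes> (A \<otimes> q)) # Q0 = X @ Y"
    using assms(5) by (simp add: P Q wtensor_def)
  then consider (l) Z where "P0 = X @ Z" "Z @ (p \<otimes> (A \<otimes> q)) # Q0 = Y"
    | (r) Z where "P0 @ Z = X" "(p \<otimes> (A \<otimes> q)) # Q0 = Z @ Y" "Z \<noteq> []"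
    unfolding append_eq_append_conv2 by (metis append_Nil append_Nil2)
  then show thesis
  proof cases
    case l
    then show thesis by (intro left[of "Z @ [p]"]) (auto simp: P Q wtensor_def)
  next
    case r
    then obtain Z' where "Z = (p \<otimes> (A \<otimes> q)) # Z'" "Q0 = Z' @ Y" by (cases Z) auto
    then show thesis using r by (intro right[of "q # Z'"]) (auto simp: P Q wtensor_def)
  qed
qed

subsection \<open>Paths and their congruence\<close>

lemma prim_dom_words [simp]: "p \<in> prims C \<Longrightarrow> prim_dom C J p \<in> words C"
  by (auto simp: prims_def dom_in simp del: singleton_wtensor)

lemma prim_cod_words [simp]: "p \<in> prims C \<Longrightarrow> prim_cod C J p \<in> words C"
  by (auto simp: prims_def cod_in simp del: singleton_wtensor)

lemma edge_dom_words: "e \<in> edges C \<Longrightarrow> edge_dom C J e \<in> words C"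
  by (auto simp: edges_def)

lemma edge_cod_words: "e \<in> edges C \<Longrightarrow> edge_cod C J e \<in> words C"
  by (auto simp: edges_def)

lemma whisker_edge_edges [simp]:
  "e \<in> edges C \<Longrightarrow> T \<in> words C \<Longrightarrow> W \<in> words C \<Longrightarrow> whisker_edge C T e W \<in> edges C"
  by (auto simp: edges_def)

lemma edge_dom_whisker [simp]:
  "e \<in> edges C \<Longrightarrow> T \<in> words C \<Longrightarrow> W \<in> words C \<Longrightarrow>
    edge_dom C J (whisker_edge C T e W) = T \<odot> (edge_dom C J e \<odot> W)"
  by (auto simp: edges_def)

lemma edge_cod_whisker [simp]:
  "e \<in> edges C \<Longrightarrow> T \<in> words C \<Longrightarrow> W \<in> words C \<Longrightarrow>
    edge_cod C J (whisker_edge C T e W) = T \<odot> (edge_cod C J e \<odot> W)"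
  by (auto simp: edges_def)

lemma whisker_edge_whisker_edge [simp]:
  assumes "e \<in> edges C" "T \<in> words C" "W \<in> words C" "T' \<in> words C" "W' \<in> words C"
  shows "whisker_edge C T' (whisker_edge C T e W) W' = whisker_edge C (T' \<odot> T) e (W \<odot> W')"
  using assms by (auto simp: edges_def)

lemma is_path_words: "is_path C J U es V \<Longrightarrow> U \<in> words C \<and> V \<in> words C \<and> set es \<subseteq> edges C"
  by (induction es arbitrary: U) (auto simp: edge_dom_words)

lemma is_path_append:
  "is_path C J U (es @ fs) V \<longleftrightarrow> (\<exists>W. is_path C J U es W \<and> is_path C J W fs V)"
  by (induction es arbitrary: U) (auto dest: is_path_words)

abbreviation whiskers :: "'o list \<Rightarrow> ('o, 'a) edge list \<Rightarrow> 'o list \<Rightarrow> ('o, 'a) edge list" where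
  "whiskers T es W \<equiv> map (\<lambda>e. whisker_edge C T e W) es"

lemma is_path_whiskers:
  assumes "is_path C J U es V" "T \<in> words C" "W \<in> words C"
  shows "is_path C J (T \<odot> (U \<odot> W)) (whiskers T es W) (T \<odot> (V \<odot> W))"
  using assms(1)
  by (induction es arbitrary: U) (use assms(2,3) in \<open>auto simp: whisker_edge_edges\<close>)

lemma whiskers_whiskers:
  assumes "set es \<subseteq> edges C" "T \<in> words C" "W \<in> words C" "T' \<in> words C" "W' \<in> words C"
  shows "whiskers T' (whiskers T es W) W' = whiskers (T' \<odot> T) es (W \<odot> W')"
  using assms by (simp add: subset_iff del: split_paired_All)

lemma in_paths [simp]: "(U, es, V) \<in> paths C J \<longleftrightarrow> is_path C J U es V"
  by (simp add: paths_def)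

lemma path_comp_paths:
  "p \<in> paths C J \<Longrightarrow> q \<in> paths C J \<Longrightarrow> path_cod p = path_dom q \<Longrightarrow> q \<bullet> p \<in> paths C J"
  by (cases p; cases q) (auto simp: is_path_append)

lemma path_dom_comp [simp]: "path_dom (q \<bullet> p) = path_dom p"
  by (cases p; cases q) auto

lemma path_cod_comp [simp]: "path_cod (q \<bullet> p) = path_cod q"
  by (cases p; cases q) auto

lemma whisker_paths:
  "p \<in> paths C J \<Longrightarrow> T \<in> words C \<Longrightarrow> W \<in> words C \<Longrightarrow> whisker C T p W \<in> paths C J"
  using is_path_whiskers[of "fst p" "fst (snd p)" "snd (snd p)" T W]
    is_path_words[of "fst p" "fst (snd p)" "snd (snd p)"]
  by (cases p) auto

lemma path_dom_whisker [simp]: "path_dom (whisker C T p W) = T \<odot> path_dom p \<odot> W"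
  by (cases p) auto

lemma path_cod_whisker [simp]: "path_cod (whisker C T p W) = T \<odot> path_cod p \<odot> W"
  by (cases p) auto

lemma prim_edge [simp]: "(wunit, p, wunit) \<in> edges C \<longleftrightarrow> p \<in> prims C"
  by (simp add: edges_def)

lemma edge_path_paths: "e \<in> edges C \<Longrightarrow> edge_path C J e \<in> paths C J"
  by (simp add: edge_path_def edge_cod_words)

lemma prim_path_eq:
  "p \<in> prims C \<Longrightarrow>
    prim_path C J p = (prim_dom C J p, [(wunit, p, wunit)], prim_cod C J p)"
  by (simp add: prim_path_def edge_path_def)

lemma prims [simp]: "Counit \<in> prims C" "Coev \<in> prims C" "Bar f \<in> prims C \<longleftrightarrow> f \<in> Arr C"
  by (auto simp: prims_def)

lemma whisker_bar_in:
  assumes "f \<in> Hom C A B" "E \<in> Obj C" "F \<in> Obj C"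
  shows "Id C E \<boxtimes> f \<boxtimes> Id C F \<in> Hom C (E \<otimes> A \<otimes> F) (E \<otimes> B \<otimes> F)"
  using assms by (intro tensorA_in id_in)

lemma basic_rel_paths:
  assumes "basic_rel C J p q"
  shows "p \<in> paths C J \<and> q \<in> paths C J \<and> path_dom p = path_dom q \<and> path_cod p = path_cod q"
  using assms
proof cases
  case (bar_whisker f E F)
  then have "Id C E \<boxtimes> f \<boxtimes> Id C F \<in> Hom C (E \<otimes> Dom C f \<otimes> F) (E \<otimes> Cod C f \<otimes> F)"
    by (intro whisker_bar_in) (simp_all add: Hom_def)
  then show ?thesis
    using bar_whisker
    by (auto simp: prim_path_eq Hom_def edges_def dom_in cod_in tensorO_in tensorO_assoc)
next
  case (bar_id A)
  then show ?thesis
    using id_in[of A] by (auto simp: prim_path_eq path_id_def Hom_def)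
next
  case (bar_comp f A B g D)
  then show ?thesis
    using comp_in[of f A B g D]
    by (auto simp: prim_path_eq Hom_def dom_in cod_in)
next
  case (interchange a U V b W X)
  then have w: "U \<in> words C" "V \<in> words C" "W \<in> words C" "X \<in> words C"
    by (auto simp: edge_dom_words edge_cod_words)
  show ?thesis
    unfolding interchange(1,2) using interchange(3-) w
    by (auto intro!: path_comp_paths whisker_paths edge_path_paths simp: edge_path_def)
next
  case triangle_J
  then show ?thesis
    by (auto intro!: path_comp_paths whisker_paths edge_path_paths
      simp: edges_def prim_path_def edge_path_def path_id_def
      simp del: singleton_wtensor wtensor_dual)
next
  case triangle_dual
  then show ?thesis
    by (auto intro!: path_comp_paths whisker_paths edge_path_paths
      simp: edges_def prim_path_def edge_path_def path_id_def
      simp del: singleton_wtensor wtensor_dual)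
qed

text \<open>The generating relations join parallel paths, and the closure rules preserve this; hence
  a class has well-defined endpoints.\<close>

lemma path_cong_paths:
  assumes "(p, q) \<in> path_cong C J"
  shows "p \<in> paths C J \<and> q \<in> paths C J \<and> path_dom p = path_dom q \<and> path_cod p = path_cod q"
  using assms
proof induction
  case (whiskered p q Y Z)
  then show ?case using basic_rel_paths whisker_paths by simp
next
  case (comp p p' q q')
  then show ?case by (simp add: path_comp_paths)
qed (auto simp: basic_rel_paths)

lemma equiv_path_cong: "equiv (paths C J) (path_cong C J)"
  by (rule equivI)
    (auto simp: refl_on_def sym_def trans_def dest: path_cong_paths
      intro: path_cong.refl path_cong.sym path_cong.trans)

text \<open>Congruence with the endpoints held fixed, so that composition becomes concatenation of
  edge lists in the order of traversal.\<close>

definition eqv :: "'o list \<Rightarrow> ('o, 'a) edge list \<Rightarrow> ('o, 'a) edge list \<Rightarrow> 'o list \<Rightarrow> bool" where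
  "eqv U es fs V \<longleftrightarrow> ((U, es, V), (U, fs, V)) \<in> path_cong C J"

lemma eqv_refl: "is_path C J U es V \<Longrightarrow> eqv U es es V"
  by (simp add: eqv_def path_cong.refl)

lemma eqv_trans [trans]: "eqv U es fs V \<Longrightarrow> eqv U fs gs V \<Longrightarrow> eqv U es gs V"
  unfolding eqv_def by (rule path_cong.trans)

lemma eqv_sym: "eqv U es fs V \<Longrightarrow> eqv U fs es V"
  unfolding eqv_def by (rule path_cong.sym)

lemma eqv_append: "eqv U es es' V \<Longrightarrow> eqv V fs fs' W \<Longrightarrow> eqv U (es @ fs) (es' @ fs') W"
  unfolding eqv_def using path_cong.comp by fastforce

lemma eqv_is_path: "eqv U es fs V \<Longrightarrow> is_path C J U es V \<and> is_path C J U fs V"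
  unfolding eqv_def using path_cong_paths by fastforce

lemma eqv_append_left:
  "is_path C J U es V \<Longrightarrow> eqv V fs fs' W \<Longrightarrow> eqv U (es @ fs) (es @ fs') W"
  by (rule eqv_append[OF eqv_refl])

lemma eqv_append_right:
  "eqv U es es' V \<Longrightarrow> is_path C J V fs W \<Longrightarrow> eqv U (es @ fs) (es' @ fs) W"
  by (rule eqv_append[OF _ eqv_refl])

section \<open>Interchange, from single edges to whole paths\<close>

lemma eqv_interchange_edges:
  assumes "a \<in> edges C" "b \<in> edges C"
  shows "eqv (edge_dom C J a \<odot> edge_dom C J b)
    [whisker_edge C wunit a (edge_dom C J b), whisker_edge C (edge_cod C J a) b wunit]
    [whisker_edge C (edge_dom C J a) b wunit, whisker_edge C wunit a (edge_cod C J b)]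
    (edge_cod C J a \<odot> edge_cod C J b)"
  using path_cong.basic[where J = J, OF interchange[OF assms(1) HOL.refl HOL.refl assms(2) HOL.refl HOL.refl]]
    assms by (simp add: eqv_def edge_path_def edge_dom_words edge_cod_words)

text \<open>By induction on \<open>fs\<close>, the edge \<open>a\<close> moves past one edge of
  \<open>fs\<close> after another.\<close>

lemma eqv_interchange_edge:
  assumes a: "a \<in> edges C" and "is_path C J W fs X"
  shows "eqv (edge_dom C J a \<odot> W)
    ([whisker_edge C wunit a W] @ whiskers (edge_cod C J a) fs wunit)
    (whiskers (edge_dom C J a) fs wunit @ [whisker_edge C wunit a X])
    (edge_cod C J a \<odot> X)"
  using assms(2)
proof (induction fs arbitrary: W)
  case Nil
  then show ?case using a
    by (auto intro!: eqv_refl simp: whisker_edge_edges edge_dom_words edge_cod_words)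
next
  case (Cons b fs)
  let ?U = "edge_dom C J a" and ?V = "edge_cod C J a" and ?Y = "edge_cod C J b"
  have b: "b \<in> edges C" "edge_dom C J b = W" and fs: "is_path C J ?Y fs X"
    using Cons.prems by auto
  have w: "?U \<in> words C" "?V \<in> words C" "W \<in> words C" "X \<in> words C" "?Y \<in> words C"
    using a b is_path_words[OF fs] by (auto simp: edge_dom_words edge_cod_words)
  have "eqv (?U \<odot> W)
      ([whisker_edge C wunit a W, whisker_edge C ?V b wunit] @ whiskers ?V fs wunit)
      ([whisker_edge C ?U b wunit, whisker_edge C wunit a ?Y] @ whiskers ?V fs wunit)
      (?V \<odot> X)"
    using eqv_interchange_edges[OF a b(1)] is_path_whiskers[OF fs, of ?V wunit] w b
    by (intro eqv_append_right[where V = "?V \<odot> ?Y"]) auto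
  moreover have "eqv (?U \<odot> W)
      ([whisker_edge C ?U b wunit] @ ([whisker_edge C wunit a ?Y] @ whiskers ?V fs wunit))
      ([whisker_edge C ?U b wunit] @ (whiskers ?U fs wunit @ [whisker_edge C wunit a X]))
      (?V \<odot> X)"
    using Cons.IH[OF fs] w b
    by (intro eqv_append_left[where V = "?U \<odot> ?Y"]) (auto simp: whisker_edge_edges)
  ultimately show ?case by (simp del: map_map) (rule eqv_trans)
qed

text \<open>By induction on \<open>es\<close>: its tail first moves past \<open>fs\<close>, then its
  first edge does so by \<open>eqv_interchange_edge\<close>.\<close>

lemma eqv_interchange:
  assumes "is_path C J U es V" and fs: "is_path C J W fs X"
  shows "eqv (U \<odot> W) (whiskers wunit es W @ whiskers V fs wunit)
    (whiskers U fs wunit @ whiskers wunit es X) (V \<odot> X)"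
  using assms(1)
proof (induction es arbitrary: U)
  case Nil
  then have "is_path C J (U \<odot> W) (whiskers U fs wunit) (U \<odot> X)"
    using is_path_whiskers[OF fs, of U wunit] is_path_words[OF fs] Nil
    by simp
  then show ?case using Nil by (auto intro: eqv_refl)
next
  case (Cons a es)
  let ?Y = "edge_cod C J a"
  have a: "a \<in> edges C" "edge_dom C J a = U" and es: "is_path C J ?Y es V"
    using Cons.prems by auto
  have w: "U \<in> words C" "?Y \<in> words C" "W \<in> words C" "X \<in> words C" "V \<in> words C"
    using a is_path_words[OF fs] is_path_words[OF es] by (auto simp: edge_dom_words edge_cod_words)
  have "eqv (U \<odot> W)
      ([whisker_edge C wunit a W] @ (whiskers wunit es W @ whiskers V fs wunit))
      ([whisker_edge C wunit a W] @ (whiskers ?Y fs wunit @ whiskers wunit es X))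
      (V \<odot> X)"
    using Cons.IH[OF es] w a
    by (intro eqv_append_left[where V = "?Y \<odot> W"]) (auto simp: whisker_edge_edges)
  moreover have "eqv (U \<odot> W)
      (([whisker_edge C wunit a W] @ whiskers ?Y fs wunit) @ whiskers wunit es X)
      ((whiskers U fs wunit @ [whisker_edge C wunit a X]) @ whiskers wunit es X)
      (V \<odot> X)"
    using eqv_interchange_edge[OF a(1) fs] is_path_whiskers[OF es, of wunit X] w a
    by (intro eqv_append_right[where V = "?Y \<odot> X"]) auto
  ultimately show ?case by (simp del: map_map) (rule eqv_trans)
qed


subsection \<open>Eliminating counits\<close>

abbreviation counit_free :: "('o, 'a) edge list \<Rightarrow> bool" where
  "counit_free es \<equiv> Counit \<notin> (\<lambda>e. fst (snd e)) ` set es"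

lemma whisker_edge_prim [simp]: "fst (snd (whisker_edge C T e W)) = fst (snd e)"
  by (cases e) auto

text \<open>The triangle identity on \<open>J\<close> inside the context \<open>P\<close>,
  \<open>V\<close>: the counit consumes the old \<open>J\<close> with the new dual, and the
  \<open>J\<close> created by the unit takes its place.\<close>

lemma eqv_coev_counit:
  assumes "P \<in> words C" "V \<in> words C"
  shows "eqv (P \<odot> ([J] \<odot> V)) [(P \<odot> [J], Coev, V), (P, Counit, [J] \<odot> V)] [] (P \<odot> ([J] \<odot> V))"
  using path_cong.whiskered[where J = J, OF triangle_J assms] assms
  by (simp add: eqv_def prim_path_eq path_id_def del: singleton_wtensor wtensor_dual)

text \<open>Since \<open>ps\<close> acts only left of the new dual and \<open>qs\<close> only right
  of it, the unit and the counit can be made adjacent. The \<open>J\<close> ending the target of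
  \<open>ps\<close> is the one the counit consumes; the \<open>J\<close> starting the source of
  \<open>qs\<close> is the one the unit creates.\<close>

lemma eqv_cancel_dual:
  assumes w: "U \<in> words C" "V \<in> words C" "P \<in> words C" "Q \<in> words C"
    and ps: "is_path C J U ps (P \<odot> [J])" and qs: "is_path C J ([J] \<odot> V) qs Q"
  shows "eqv (U \<odot> V)
    ((U, Coev, V) # whiskers wunit ps (dual \<odot> ([J] \<odot> V)) @
      whiskers (P \<odot> [J] \<odot> dual) qs wunit @ [(P, Counit, Q)])
    (whiskers wunit ps V @ whiskers P qs wunit) (P \<odot> Q)"
proof -
  let ?M = "P \<odot> ([J] \<odot> (dual \<odot> ([J] \<odot> V)))"
  have e: "(wunit, Coev, V) \<in> edges C" "(P, Counit, wunit) \<in> edges C"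
    using w by (auto simp: edges_def)
  have "is_path C J V [(wunit, Coev, V)] (dual \<odot> ([J] \<odot> V))"
    using e w by (simp del: singleton_wtensor wtensor_dual)
  from eqv_interchange[OF ps this]
  \<comment> \<open>The unit is postponed until after \<open>ps\<close>.\<close>
  have 1: "eqv (U \<odot> V) (whiskers wunit ps V @ [(P \<odot> [J], Coev, V)])
      ((U, Coev, V) # whiskers wunit ps (dual \<odot> ([J] \<odot> V))) ?M"
    using w by (simp del: singleton_wtensor wtensor_dual)
  have "is_path C J (P \<odot> [J] \<odot> dual) [(P, Counit, wunit)] P"
    using e w by (simp del: singleton_wtensor wtensor_dual)
  from eqv_interchange[OF this qs]
  \<comment> \<open>The counit is advanced before \<open>qs\<close>.\<close>
  have 2: "eqv ?M ((P, Counit, [J] \<odot> V) # whiskers P qs wunit)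
      (whiskers (P \<odot> [J] \<odot> dual) qs wunit @ [(P, Counit, Q)]) (P \<odot> Q)"
    using w is_path_words[OF qs] by (simp del: singleton_wtensor wtensor_dual)
  have p: "is_path C J (U \<odot> V) (whiskers wunit ps V) (P \<odot> ([J] \<odot> V))"
    using is_path_whiskers[OF ps, of wunit V] w by (simp del: singleton_wtensor)
  have q: "is_path C J (P \<odot> ([J] \<odot> V)) (whiskers P qs wunit) (P \<odot> Q)"
    using is_path_whiskers[OF qs, of P wunit] w by (simp del: singleton_wtensor)
  have "eqv (U \<odot> V)
      ((whiskers wunit ps V @ [(P \<odot> [J], Coev, V)]) @ ((P, Counit, [J] \<odot> V) # whiskers P qs wunit))
      (((U, Coev, V) # whiskers wunit ps (dual \<odot> ([J] \<odot> V))) @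
        (whiskers (P \<odot> [J] \<odot> dual) qs wunit @ [(P, Counit, Q)])) (P \<odot> Q)"
    by (rule eqv_append[OF 1 2])
  \<comment> \<open>Unit and counit now meet in the middle and cancel by the triangle.\<close>
  moreover have "eqv (U \<odot> V)
      (whiskers wunit ps V @ ([(P \<odot> [J], Coev, V), (P, Counit, [J] \<odot> V)] @ whiskers P qs wunit))
      (whiskers wunit ps V @ ([] @ whiskers P qs wunit)) (P \<odot> Q)"
    by (intro eqv_append_left[OF p] eqv_append_right[OF eqv_coev_counit q] w)
  ultimately show ?thesis by (simp del: map_map) (blast intro: eqv_trans eqv_sym)
qed

text \<open>
  The words of the form \<open>X \<otimes> J\<^sup>\<or> \<otimes> Y\<close> are the lists \<open>X @ Y\<close> (\<open>wtensor_dual\<close>), so splitting a list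
  in two amounts to singling out one copy of \<open>J\<^sup>\<or>\<close>.
\<close>

lemma edge_into_append_cases:
  assumes e: "e \<in> edges C" "fst (snd e) \<noteq> Counit" "edge_cod C J e = X @ Y"
    and w: "X \<in> words C" "Y \<in> words C"
  obtains (left) e' where "e' \<in> edges C" "e = whisker_edge C wunit e' (dual \<odot> Y)"
      "edge_cod C J e' = X"
  | (right) e' where "e' \<in> edges C" "e = whisker_edge C (X \<odot> dual) e' wunit"
      "edge_cod C J e' = Y"
  | (coev) V where "V \<in> words C" "e = (X, Coev, V)" "Y = [J] \<odot> V"
proof -
  obtain P p Q where eq: "e = (P, p, Q)" by (cases e)
  have PQ: "P \<in> words C" "Q \<in> words C" "p \<in> prims C"
    using e by (auto simp: eq edges_def)
  have ne: "X \<noteq> []" "Y \<noteq> []" using w words_not_Nil by auto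
  \<comment> \<open>A boundary inside the right context means that the edge touches only
    \<open>X\<close>; \<open>dual \<odot> Y\<close> is split off from \<open>Q\<close>. The fact
    \<open>R\<close> is the mirror image.\<close>
  have L: thesis if "Q = Q' @ Y" "Q' \<noteq> []" "P \<odot> (prim_cod C J p \<odot> Q') = X" for Q'
  proof (rule left[of "(P, p, Q')"])
    have "Q' \<in> words C" using that PQ ne by auto
    then show "(P, p, Q') \<in> edges C" "e = whisker_edge C wunit (P, p, Q') (dual \<odot> Y)"
      "edge_cod C J (P, p, Q') = X"
      using that PQ w by (auto simp: edges_def eq)
  qed
  have R: thesis if "P = X @ P'" "P' \<noteq> []" "P' \<odot> (prim_cod C J p \<odot> Q) = Y" for P'
  proof (rule right[of "(P', p, Q)"])
    have "P' \<in> words C" using that PQ ne by auto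
    then show "(P', p, Q) \<in> edges C" "e = whisker_edge C (X \<odot> dual) (P', p, Q) wunit"
      "edge_cod C J (P', p, Q) = Y"
      using that PQ w by (auto simp: edges_def eq)
  qed
  show thesis
  proof (cases p)
    case Counit
    then show thesis using e by (simp add: eq)
  next
    case (Bar f)
    then have "P \<odot> ([Cod C f] \<odot> Q) = X @ Y" using e PQ by (simp add: eq cod_in)
    then show thesis
      by (rule wtensor_singleton_eq_append[OF PQ(1,2) ne]) (use L R Bar in auto)
  next
    case Coev
    \<comment> \<open>The dual created by a unit is the boundary just before the entry containing
      the new \<open>J\<close>.\<close>
    have c: "T \<odot> (prim_cod C J p \<odot> S) = T @ ([J] \<odot> S)" if "T \<in> words C" "S \<in> words C" for T S
      using that by (simp add: Coev del: singleton_wtensor)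
    have "P @ ([J] \<odot> Q) = X @ Y"
      using e(3) PQ c[OF PQ(1,2)] by (simp add: eq)
    \<comment> \<open>The singled-out dual is the newly created one, or an older one in
      \<open>P\<close> or in \<open>Q\<close>.\<close>
    then consider (m) "P = X" "[J] \<odot> Q = Y"
      | (l) Z where "Z \<noteq> []" "P = X @ Z" "Z @ ([J] \<odot> Q) = Y"
      | (r) Z where "Z \<noteq> []" "X = P @ Z" "[J] \<odot> Q = Z @ Y"
      unfolding append_eq_append_conv2 by (metis append_Nil append_Nil2)
    then show thesis
    proof cases
      case m
      then show thesis using coev[OF PQ(2)] by (simp add: eq Coev)
    next
      case l
      then have "Z \<in> words C" using PQ ne by simp
      then show thesis using R[of Z] l c PQ by simp
    next
      case r
      \<comment> \<open>The new \<open>J\<close> is fused with the first entry of \<open>Q\<close>,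
        so a later boundary lies properly inside \<open>Q\<close>.\<close>
      have "(J \<otimes> hd Q) # tl Q = Z @ Y" using r(3) by (simp add: wtensor_def)
      then obtain Z' where Z: "Z = (J \<otimes> hd Q) # Z'" "tl Q = Z' @ Y" using r(1) by (cases Z) auto
      have Q: "Q = (hd Q # Z') @ Y" using Z words_not_Nil[OF PQ(2)] by (cases Q) auto
      then have "hd Q # Z' \<in> words C" using PQ(2) ne words_append[of "hd Q # Z'" Y] by auto
      moreover have "[J] \<odot> (hd Q # Z') = Z" by (simp add: Z wtensor_def)
      ultimately show thesis using L[OF Q] c PQ r by simp
    qed
  qed
qed

text \<open>The one-entry word \<open>[A]\<close> contains no dual, so the one between
  \<open>X\<close> and \<open>Y\<close> was created by some unit on the way; \<open>rs\<close>
  precedes that unit, and \<open>ps\<close> and \<open>qs\<close> collect what later happens on its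
  two sides. The induction removes the last edge, so as to trace this dual backwards.\<close>

lemma counit_free_factorization:
  assumes "is_path C J [A] es (X @ Y)" "counit_free es" "X \<in> words C" "Y \<in> words C"
  shows "\<exists>U V rs ps qs. U \<in> words C \<and> V \<in> words C \<and>
    is_path C J [A] rs (U \<odot> V) \<and> is_path C J U ps X \<and> is_path C J ([J] \<odot> V) qs Y \<and>
    counit_free rs \<and> counit_free ps \<and> counit_free qs \<and>
    eqv [A] es (rs @ (U, Coev, V) # whiskers wunit ps (dual \<odot> ([J] \<odot> V)) @
      whiskers (X \<odot> dual) qs wunit) (X @ Y)"
  using assms
proof (induction es arbitrary: X Y rule: rev_induct)
  case Nil
  then show ?case using words_not_Nil by (auto simp: Cons_eq_append_conv)
next
  case (snoc e es)
  obtain W where es: "is_path C J [A] es W" and e: "e \<in> edges C" "edge_dom C J e = W"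
      "edge_cod C J e = X @ Y" and cf: "counit_free es" "fst (snd e) \<noteq> Counit"
    using snoc.prems by (auto simp: is_path_append)
  have w: "X \<in> words C" "Y \<in> words C" by fact+
  from e(1) cf(2) e(3) w show ?case
  proof (cases rule: edge_into_append_cases)
    \<comment> \<open>The last edge creates the dual: everything before it is \<open>rs\<close>, and
      both side paths are empty.\<close>
    case (coev V)
    then have "W = X \<odot> V" using e w by simp
    moreover have "eqv [A] (es @ [e]) (es @ [(X, Coev, V)]) (X @ Y)"
      using snoc.prems(1) by (auto simp flip: coev intro: eqv_refl)
    ultimately show ?thesis
      using coev w es cf
      by (intro exI[of _ X] exI[of _ V] exI[of _ es] exI[of _ "[]"]) (simp del: singleton_wtensor)
  next
    \<comment> \<open>In the normal form \<open>qs\<close> comes last, so the edge is simply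
      appended to it.\<close>
    case (right e')
    let ?Y = "edge_dom C J e'"
    have W: "W = X @ ?Y" and wY: "?Y \<in> words C"
      using e(2) right w by (auto simp: edge_dom_words)
    obtain U V rs ps qs where IH: "U \<in> words C" "V \<in> words C"
      "is_path C J [A] rs (U \<odot> V)" "is_path C J U ps X" "is_path C J ([J] \<odot> V) qs ?Y"
      "counit_free rs" "counit_free ps" "counit_free qs"
      "eqv [A] es (rs @ (U, Coev, V) # whiskers wunit ps (dual \<odot> ([J] \<odot> V)) @
        whiskers (X \<odot> dual) qs wunit) (X @ ?Y)"
      using snoc.IH[OF es[unfolded W] cf(1) w(1) wY] by blast
    have "is_path C J (X @ ?Y) [e] (X @ Y)" using e W w by simp
    from eqv_append_right[OF IH(9) this]
    have "eqv [A] (es @ [e]) (rs @ (U, Coev, V) # whiskers wunit ps (dual \<odot> ([J] \<odot> V)) @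
        whiskers (X \<odot> dual) (qs @ [e']) wunit) (X @ Y)"
      by (simp add: right(2))
    moreover have "is_path C J ([J] \<odot> V) (qs @ [e']) Y"
      unfolding is_path_append using IH(5) right w by auto
    moreover have "counit_free (qs @ [e'])"
      using IH(8) right cf(2) by simp
    ultimately show ?thesis
      by (intro exI[of _ U] exI[of _ V] exI[of _ rs] exI[of _ ps] exI[of _ "qs @ [e']"] conjI IH)
  next
    \<comment> \<open>The edge must join \<open>ps\<close> and therefore has to be moved in front of
      all of \<open>qs\<close>.\<close>
    case (left e')
    let ?X = "edge_dom C J e'" and ?e = "\<lambda>W. whisker_edge C wunit e' W"
    have W: "W = ?X @ Y" and wX: "?X \<in> words C"
      using e(2) left w by (auto simp: edge_dom_words)
    obtain U V rs ps qs where IH: "U \<in> words C" "V \<in> words C"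
      "is_path C J [A] rs (U \<odot> V)" "is_path C J U ps ?X" "is_path C J ([J] \<odot> V) qs Y"
      "counit_free rs" "counit_free ps" "counit_free qs"
      "eqv [A] es (rs @ (U, Coev, V) # whiskers wunit ps (dual \<odot> ([J] \<odot> V)) @
        whiskers (?X \<odot> dual) qs wunit) (?X @ Y)"
      using snoc.IH[OF es[unfolded W] cf(1) wX w(2)] by blast
    let ?V = "dual \<odot> ([J] \<odot> V)"
    let ?ps = "whiskers wunit ps ?V"
    have qs: "set qs \<subseteq> edges C" using is_path_words[OF IH(5)] by simp
    have "is_path C J (?X @ Y) [e] (X @ Y)" using e W w by simp
    note step1 = eqv_append_right[OF IH(9) this]
    have "is_path C J ?X [e'] X" using left w by simp
    moreover have "is_path C J ?V (whiskers dual qs wunit) (dual \<odot> Y)"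
      using is_path_whiskers[OF IH(5), of dual wunit] IH w
      by (simp del: singleton_wtensor wtensor_dual)
    \<comment> \<open>Whiskering \<open>qs\<close> by \<open>dual\<close> first makes it a path on
      the right tensor factor \<open>?V\<close>, to which interchange applies.\<close>
    ultimately have "eqv (?X \<odot> ?V)
        ([?e ?V] @ whiskers X (whiskers dual qs wunit) wunit)
        (whiskers ?X (whiskers dual qs wunit) wunit @ [?e (dual \<odot> Y)]) (X \<odot> (dual \<odot> Y))"
      using eqv_interchange[of ?X "[e']" X ?V "whiskers dual qs wunit" "dual \<odot> Y"] w
      by (simp del: map_map wtensor_dual)
    then have "eqv (?X \<odot> ?V)
        ([?e ?V] @ whiskers (X \<odot> dual) qs wunit)
        (whiskers (?X \<odot> dual) qs wunit @ [e]) (X @ Y)"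
      using qs left w wX by (simp add: whiskers_whiskers del: map_map)
    note interchange = eqv_sym[OF this]
    have "is_path C J (U \<odot> ?V) ?ps (?X \<odot> ?V)"
      using is_path_whiskers[OF IH(4), of wunit ?V] IH(1,2) wX
      by (simp del: singleton_wtensor wtensor_dual)
    then have "is_path C J (U \<odot> V) ((U, Coev, V) # ?ps) (?X \<odot> ?V)"
      using IH(1,2) by (simp add: edges_def del: singleton_wtensor wtensor_dual)
    then have "is_path C J [A] (rs @ (U, Coev, V) # ?ps) (?X \<odot> ?V)"
      using IH(3) unfolding is_path_append by blast
    note step2 = eqv_append_left[OF this interchange]
    have "eqv [A] (es @ [e]) (rs @ (U, Coev, V) # whiskers wunit (ps @ [e']) ?V @
        whiskers (X \<odot> dual) qs wunit) (X @ Y)"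
      using eqv_trans[OF step1] step2 by simp
    moreover have "is_path C J U (ps @ [e']) X"
      unfolding is_path_append using IH(4) left w by auto
    moreover have "counit_free (ps @ [e'])"
      using IH(7) left cf(2) by simp
    ultimately show ?thesis
      by (intro exI[of _ U] exI[of _ V] exI[of _ rs] exI[of _ "ps @ [e']"] exI[of _ qs] conjI IH)
  qed
qed

text \<open>By induction from the end, the path before the last edge is already free of counits. If
  the last edge is a counit, tracing its dual back by \<open>counit_free_factorization\<close> and
  cancelling by \<open>eqv_cancel_dual\<close> leaves only pieces without counits.\<close>

lemma eqv_counit_free:
  assumes "is_path C J [A] es V"
  shows "\<exists>fs. counit_free fs \<and> eqv [A] es fs V"
  using assms
proof (induction es arbitrary: V rule: rev_induct)
  case Nil
  then show ?case by (intro exI[of _ "[]"]) (use Nil in \<open>auto intro: eqv_refl\<close>)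
next
  case (snoc e es)
  obtain W where es: "is_path C J [A] es W" and e: "is_path C J W [e] V"
    using snoc.prems by (auto simp: is_path_append)
  obtain fs where fs: "counit_free fs" "eqv [A] es fs W" using snoc.IH[OF es] by blast
  have ext: "eqv [A] (es @ [e]) (fs @ [e]) V" by (rule eqv_append_right[OF fs(2) e])
  obtain P p Q where eq: "e = (P, p, Q)" by (cases e)
  have w: "P \<in> words C" "Q \<in> words C" using e by (auto simp: eq edges_def)
  show ?case
  proof (cases "p = Counit")
    case False
    then show ?thesis using fs ext by (intro exI[of _ "fs @ [e]"]) (auto simp: eq)
  next
    case True
    \<comment> \<open>The boundary in front of \<open>Q\<close> is the dual that the counit is about
      to delete.\<close>
    have W: "W = P \<odot> [J] @ Q" and V: "V = P \<odot> Q"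
      using e w by (auto simp: eq True simp flip: wtensor_dual)
    have "is_path C J [A] fs (P \<odot> [J] @ Q)" using eqv_is_path[OF fs(2)] W by simp
    from counit_free_factorization[OF this fs(1) _ w(2)] w
    obtain U V' rs ps qs where f: "U \<in> words C" "V' \<in> words C"
      "is_path C J [A] rs (U \<odot> V')" "is_path C J U ps (P \<odot> [J])" "is_path C J ([J] \<odot> V') qs Q"
      "counit_free rs" "counit_free ps" "counit_free qs"
      "eqv [A] fs (rs @ (U, Coev, V') # whiskers wunit ps (dual \<odot> ([J] \<odot> V')) @
        whiskers (P \<odot> [J] \<odot> dual) qs wunit) (P \<odot> [J] @ Q)"
      by (auto simp del: singleton_wtensor wtensor_assoc wtensor_dual)
    note ext
    also have "eqv [A] (fs @ [e]) ((rs @ (U, Coev, V') # whiskers wunit ps (dual \<odot> ([J] \<odot> V')) @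
        whiskers (P \<odot> [J] \<odot> dual) qs wunit) @ [e]) V"
      using e W eqv_append_right[OF f(9), of "[e]" V] by auto
    also have "eqv [A] ((rs @ (U, Coev, V') # whiskers wunit ps (dual \<odot> ([J] \<odot> V')) @
        whiskers (P \<odot> [J] \<odot> dual) qs wunit) @ [e]) (rs @ whiskers wunit ps V' @ whiskers P qs wunit) V"
      using eqv_append_left[OF f(3) eqv_cancel_dual[OF f(1,2) w f(4,5)]]
      by (simp add: eq True V del: singleton_wtensor wtensor_assoc wtensor_dual)
    finally show ?thesis using f(6-8)
      by (intro exI[of _ "rs @ whiskers wunit ps V' @ whiskers P qs wunit"])
        (simp add: image_Un image_image)
  qed
qed

section \<open>Paths without counits between objects of \<open>C\<close>\<close>

text \<open>A bar keeps the number of entries and a unit adds one; whiskering preserves these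
  differences.\<close>

lemma counit_free_length:
  assumes "is_path C J U es V" "counit_free es"
  shows "length U \<le> length V"
  using assms
proof (induction es arbitrary: U)
  case (Cons e es)
  obtain P p Q where eq: "e = (P, p, Q)" by (cases e)
  have w: "P \<in> words C" "Q \<in> words C" "p \<in> prims C" and p: "p \<noteq> Counit"
    using Cons.prems by (auto simp: eq edges_def)
  have "length (prim_dom C J p) \<le> length (prim_cod C J p)"
    using p by (cases p) (auto simp: dual_word_def wtensor_def)
  then have "length (edge_dom C J e) \<le> length (edge_cod C J e)"
    using length_wtensor'[of P "prim_dom C J p \<odot> Q"] length_wtensor'[of P "prim_cod C J p \<odot> Q"]
      length_wtensor'[of "prim_dom C J p" Q] length_wtensor'[of "prim_cod C J p" Q] w
    by (simp add: eq)
  moreover have "length (edge_cod C J e) \<le> length V" using Cons by auto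
  ultimately show ?case using Cons.prems by auto
qed simp

lemma eqv_bar_comp:
  assumes "f \<in> Hom C A B" "g \<in> Hom C B D"
  shows "eqv [A] [(wunit, Bar f, wunit), (wunit, Bar g, wunit)] [(wunit, Bar (g \<cdot> f), wunit)] [D]"
  using path_cong.basic[where J = J, OF bar_comp[OF assms], THEN path_cong.sym] assms comp_in[OF assms]
  by (auto simp: eqv_def prim_path_eq Hom_def)

lemma eqv_bar_whisker:
  assumes "f \<in> Hom C A B" "E \<in> Obj C" "F \<in> Obj C"
  shows "eqv [E \<otimes> A \<otimes> F] [([E], Bar f, [F])]
    [(wunit, Bar (Id C E \<boxtimes> f \<boxtimes> Id C F), wunit)] [E \<otimes> B \<otimes> F]"
  using path_cong.basic[where J = J, OF bar_whisker, of f C E F, THEN path_cong.sym] assms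
    whisker_bar_in[OF assms]
  by (auto simp: eqv_def prim_path_eq Hom_def)

text \<open>Word lengths cannot drop, so every word on the way has one entry and every edge is a bar
  between objects; relation (i) absorbs its whiskering and relation (ii) composes the
  results.\<close>

lemma counit_free_bar:
  assumes "is_path C J [A] es [B]" "counit_free es"
  shows "\<exists>f \<in> Hom C A B. eqv [A] es [(wunit, Bar f, wunit)] [B]"
  using assms
proof (induction es arbitrary: A)
  case Nil
  then have "A = B" "A \<in> Obj C" by auto
  then show ?case
    using path_cong.basic[where J = J, OF bar_id, of A C, THEN path_cong.sym] id_in[of A]
    by (intro bexI[of _ "Id C A"]) (auto simp: eqv_def prim_path_eq path_id_def Hom_def)
next
  case (Cons e es)
  obtain P p Q where eq: "e = (P, p, Q)" by (cases e)
  have w: "P \<in> words C" "Q \<in> words C" "p \<in> prims C" "p \<noteq> Counit"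
    and dom: "P \<odot> prim_dom C J p \<odot> Q = [A]"
    and es: "is_path C J (edge_cod C J e) es [B]" "counit_free es"
    using Cons.prems by (auto simp: eq edges_def)
  \<comment> \<open>The rest of the path ends in a one-entry word, which bounds the length here;
    additivity of lengths then makes \<open>P\<close>, \<open>Q\<close> and the codomain of
    \<open>p\<close> single objects.\<close>
  have "length (P \<odot> (prim_cod C J p \<odot> Q)) \<le> 1"
    using counit_free_length[OF es] w by (simp add: eq)
  moreover have "length (P \<odot> (prim_cod C J p \<odot> Q)) + 1 = length P + length (prim_cod C J p \<odot> Q)"
    "length (prim_cod C J p \<odot> Q) + 1 = length (prim_cod C J p) + length Q"
    using w by (simp_all only: length_wtensor' wtensor_words prim_cod_words)
  moreover have "0 < length P" "0 < length Q" "0 < length (prim_cod C J p)"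
    using w words_not_Nil prim_cod_words length_greater_0_conv by blast+
  ultimately have "length P = 1 \<and> length Q = 1 \<and> length (prim_cod C J p) = 1"
    by linarith
  then obtain E F where EF: "P = [E]" "Q = [F]" and p1: "length (prim_cod C J p) = 1"
    by (auto simp: length_Suc_conv)
  \<comment> \<open>The codomain of the unit has two entries.\<close>
  have "p \<noteq> Coev" using p1 by (auto simp: dual_word_def wtensor_def)
  then obtain f where p: "p = Bar f" using w by (cases p) auto
  have o: "E \<in> Obj C" "F \<in> Obj C" "f \<in> Hom C (Dom C f) (Cod C f)"
    using w by (auto simp: EF p Hom_def)
  have A: "A = E \<otimes> Dom C f \<otimes> F" and cod: "edge_cod C J e = [E \<otimes> Cod C f \<otimes> F]"
    using dom by (auto simp: eq EF p)
  obtain g where g: "g \<in> Hom C (E \<otimes> Cod C f \<otimes> F) B"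
    "eqv [E \<otimes> Cod C f \<otimes> F] es [(wunit, Bar g, wunit)] [B]"
    using Cons.IH[OF es(1)[unfolded cod] es(2)] by blast
  let ?f = "Id C E \<boxtimes> f \<boxtimes> Id C F"
  note fh = whisker_bar_in[OF o(3,1,2)]
  have "eqv [A] ([e] @ es) ([(wunit, Bar ?f, wunit)] @ [(wunit, Bar g, wunit)]) [B]"
    using eqv_append[OF eqv_bar_whisker[OF o(3,1,2)] g(2)] by (simp add: A eq EF p)
  also have "eqv [A] ([(wunit, Bar ?f, wunit)] @ [(wunit, Bar g, wunit)])
      [(wunit, Bar (g \<cdot> ?f), wunit)] [B]"
    using eqv_bar_comp[OF fh g(1)] by (simp add: A)
  finally show ?case
    using comp_in[OF fh g(1)] by (auto simp: A)
qed

subsection \<open>The quotient category\<close>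

definition path_class :: "('o, 'a) path \<Rightarrow> ('o, 'a) path set" where
  "path_class p = path_cong C J `` {p}"

lemma path_class_eq: "(p, q) \<in> path_cong C J \<Longrightarrow> path_class p = path_class q"
  unfolding path_class_def by (rule equiv_class_eq[OF equiv_path_cong])

lemma path_class_self: "p \<in> paths C J \<Longrightarrow> p \<in> path_class p"
  by (simp add: path_class_def path_cong.refl)

text \<open>With \<open>h\<close> an endpoint map, this evaluates \<open>the_elem\<close> in
  \<open>Dom\<close> and \<open>Cod\<close>.\<close>

lemma path_class_image:
  assumes "p \<in> paths C J" "\<And>q. (p, q) \<in> path_cong C J \<Longrightarrow> h q = h p"
  shows "h ` path_class p = {h p}"
proof -
  have "h ` path_class p = (\<lambda>_. h p) ` path_class p"
    by (rule image_cong[OF HOL.refl], rule assms(2)) (simp add: path_class_def)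
  then show ?thesis using image_constant[OF path_class_self[OF assms(1)]] by simp
qed

lemma Arr_adjoin_dual: "Arr (adjoin_dual C J) = path_class ` paths C J"
  by (auto simp: adjoin_dual_def quotient_def path_class_def)

lemma Dom_path_class: "p \<in> paths C J \<Longrightarrow> Dom (adjoin_dual C J) (path_class p) = path_dom p"
  by (simp add: adjoin_dual_def path_class_image path_cong_paths)

lemma Cod_path_class: "p \<in> paths C J \<Longrightarrow> Cod (adjoin_dual C J) (path_class p) = path_cod p"
  by (simp add: adjoin_dual_def path_class_image path_cong_paths)

lemma Hom_adjoin_dual:
  "Hom (adjoin_dual C J) U V = (\<lambda>es. path_class (U, es, V)) ` {es. is_path C J U es V}"
  by (auto simp: Hom_def Arr_adjoin_dual Dom_path_class Cod_path_class image_iff)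

text \<open>The union over representatives collapses, because composition respects the
  congruence.\<close>

lemma Comp_path_class:
  assumes "is_path C J U es V" "is_path C J V fs W"
  shows "path_class (V, fs, W) \<cdot>\<^bsub>adjoin_dual C J\<^esub> path_class (U, es, V) = path_class (U, es @ fs, W)"
proof -
  have "path_class (q \<bullet> p) = path_class (U, es @ fs, W)"
    if "q \<in> path_class (V, fs, W)" "p \<in> path_class (U, es, V)" for p q
    using that path_cong.comp[of "(U, es, V)" p C J "(V, fs, W)" q]
    by (auto simp: path_class_def intro!: path_class_eq[unfolded path_class_def, symmetric])
  then have "(\<Union>q\<in>path_class (V, fs, W). \<Union>p\<in>path_class (U, es, V). path_class (q \<bullet> p)) =
      path_class (U, es @ fs, W)"
    using path_class_self[of "(V, fs, W)"] path_class_self[of "(U, es, V)"] assms by auto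
  then show ?thesis by (simp add: adjoin_dual_def path_class_def)
qed

lemma Id_adjoin_dual: "Id (adjoin_dual C J) U = path_class (U, [], U)"
  by (simp add: adjoin_dual_def path_class_def path_id_def)

lemma Obj_adjoin_dual: "Obj (adjoin_dual C J) = words C"
  by (simp add: adjoin_dual_def)

lemma path_class_in_Hom: "is_path C J U es V \<Longrightarrow> path_class (U, es, V) \<in> Hom (adjoin_dual C J) U V"
  by (auto simp: Hom_adjoin_dual)

lemma Hom_adjoin_dualE:
  assumes "f \<in> Hom (adjoin_dual C J) U V"
  obtains es where "f = path_class (U, es, V)" "is_path C J U es V"
  using assms by (auto simp: Hom_adjoin_dual)

lemma category_adjoin_dual: "category (adjoin_dual C J)"
proof
  fix f assume "f \<in> Arr (adjoin_dual C J)"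
  then obtain U es V where "f = path_class (U, es, V)" "is_path C J U es V"
    by (auto simp: Arr_adjoin_dual)
  then show "Dom (adjoin_dual C J) f \<in> Obj (adjoin_dual C J)"
    "Cod (adjoin_dual C J) f \<in> Obj (adjoin_dual C J)"
    by (auto simp: Dom_path_class Cod_path_class Obj_adjoin_dual dest: is_path_words)
next
  fix U assume "U \<in> Obj (adjoin_dual C J)"
  then show "Id (adjoin_dual C J) U \<in> Hom (adjoin_dual C J) U U"
    by (simp add: Id_adjoin_dual Obj_adjoin_dual path_class_in_Hom)
next
  fix f g U V W assume "f \<in> Hom (adjoin_dual C J) U V" "g \<in> Hom (adjoin_dual C J) V W"
  then obtain es fs where *: "f = path_class (U, es, V)" "is_path C J U es V"
    "g = path_class (V, fs, W)" "is_path C J V fs W" by (elim Hom_adjoin_dualE)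
  then have "is_path C J U (es @ fs) W" unfolding is_path_append by blast
  then show "g \<cdot>\<^bsub>adjoin_dual C J\<^esub> f \<in> Hom (adjoin_dual C J) U W"
    by (simp add: *(1,3) Comp_path_class[OF *(2,4)] path_class_in_Hom)
next
  fix f U V assume "f \<in> Hom (adjoin_dual C J) U V"
  then obtain es where *: "f = path_class (U, es, V)" "is_path C J U es V"
    by (elim Hom_adjoin_dualE)
  have "is_path C J U [] U" "is_path C J V [] V" using is_path_words[OF *(2)] by simp_all
  then show "f \<cdot>\<^bsub>adjoin_dual C J\<^esub> Id (adjoin_dual C J) U = f"
    "Id (adjoin_dual C J) V \<cdot>\<^bsub>adjoin_dual C J\<^esub> f = f"
    using Comp_path_class *(2) by (simp_all add: *(1) Id_adjoin_dual)
next
  fix f g h U V W X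
  assume "f \<in> Hom (adjoin_dual C J) U V" "g \<in> Hom (adjoin_dual C J) V W"
    "h \<in> Hom (adjoin_dual C J) W X"
  then obtain es fs gs where *: "f = path_class (U, es, V)" "is_path C J U es V"
    "g = path_class (V, fs, W)" "is_path C J V fs W"
    "h = path_class (W, gs, X)" "is_path C J W gs X" by (elim Hom_adjoin_dualE)
  then have "is_path C J U (es @ fs) W" "is_path C J V (fs @ gs) X"
    unfolding is_path_append by blast+
  then show "h \<cdot>\<^bsub>adjoin_dual C J\<^esub> g \<cdot>\<^bsub>adjoin_dual C J\<^esub> f =
      h \<cdot>\<^bsub>adjoin_dual C J\<^esub> (g \<cdot>\<^bsub>adjoin_dual C J\<^esub> f)"
    using *(2,4,6) by (simp add: *(1,3,5) Comp_path_class)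
qed

section \<open>The inclusion functor and its fullness\<close>

lemma incl_arr_eq:
  "f \<in> Hom C A B \<Longrightarrow> incl_arr C J f = path_class ([A], [(wunit, Bar f, wunit)], [B])"
  by (auto simp: incl_arr_def path_class_def prim_path_eq Hom_def)

lemma is_path_bar: "f \<in> Hom C A B \<Longrightarrow> is_path C J [A] [(wunit, Bar f, wunit)] [B]"
  by (auto simp: Hom_def dom_in cod_in)

text \<open>Functoriality is exactly relation (ii).\<close>

lemma cat_functor_incl: "cat_functor C (adjoin_dual C J) incl_obj (incl_arr C J)"
proof -
  interpret B: category "adjoin_dual C J" by (rule category_adjoin_dual)
  show ?thesis
  proof
    fix X assume X: "X \<in> Obj C"
    then show "incl_obj X \<in> Obj (adjoin_dual C J)"
      by (simp add: incl_obj_def Obj_adjoin_dual)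
    show "incl_arr C J (Id C X) = Id (adjoin_dual C J) (incl_obj X)"
      using path_class_eq[OF path_cong.basic[where J = J, OF bar_id[OF X]]]
      by (simp add: incl_arr_def Id_adjoin_dual path_class_def incl_obj_def path_id_def)
  next
    fix f X Y assume "f \<in> Hom C X Y"
    then show "incl_arr C J f \<in> Hom (adjoin_dual C J) (incl_obj X) (incl_obj Y)"
      by (simp add: incl_arr_eq incl_obj_def path_class_in_Hom[OF is_path_bar])
  next
    fix f X Y g Z assume fg: "f \<in> Hom C X Y" "g \<in> Hom C Y Z"
    have "path_class ([X], [(wunit, Bar f, wunit), (wunit, Bar g, wunit)], [Z]) =
        path_class ([X], [(wunit, Bar (g \<cdot> f), wunit)], [Z])"
      by (rule path_class_eq[OF eqv_bar_comp[OF fg, unfolded eqv_def]])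
    then show "incl_arr C J (g \<cdot> f) = incl_arr C J g \<cdot>\<^bsub>adjoin_dual C J\<^esub> incl_arr C J f"
      using Comp_path_class[OF is_path_bar[OF fg(1)] is_path_bar[OF fg(2)]]
      by (simp add: incl_arr_eq[OF fg(1)] incl_arr_eq[OF fg(2)] incl_arr_eq[OF comp_in[OF fg]])
  qed
qed

lemma full_functor_incl: "full_functor C (adjoin_dual C J) incl_obj (incl_arr C J)"
proof -
  interpret cat_functor C "adjoin_dual C J" incl_obj "incl_arr C J" by (rule cat_functor_incl)
  show ?thesis
  proof
    fix X Y g assume "g \<in> Hom (adjoin_dual C J) (incl_obj X) (incl_obj Y)"
    then obtain es where es: "is_path C J [X] es [Y]" "g = path_class ([X], es, [Y])"
      by (auto simp: Hom_adjoin_dual incl_obj_def)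
    \<comment> \<open>A representing path of \<open>g\<close> is first freed of counits and then
      contracted to a single bar, whose morphism is the preimage.\<close>
    obtain fs where fs: "counit_free fs" "eqv [X] es fs [Y]"
      using eqv_counit_free[OF es(1)] by blast
    then obtain f where f: "f \<in> Hom C X Y" "eqv [X] fs [(wunit, Bar f, wunit)] [Y]"
      using counit_free_bar eqv_is_path by blast
    have "g = incl_arr C J f"
      using eqv_trans[OF fs(2) f(2)] path_class_eq es(2) incl_arr_eq[OF f(1)]
      by (simp add: eqv_def)
    then show "\<exists>f\<in>Hom C X Y. incl_arr C J f = g" using f(1) by blast
  qed
qed

end

theorem proposition15:
  fixes C :: "('o, 'a) moncat" and J :: 'o
  assumes "strict_monoidal_category C" and "J \<in> Obj C"
  shows "full_functor C (adjoin_dual C J) incl_obj (incl_arr C J)"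
proof -
  interpret strict_monoidal_category C by fact
  interpret pointed_monoidal_category C J by unfold_locales fact
  show ?thesis by (rule full_functor_incl)
qed

end
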